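(* Let $\mathcal A,\mathcal E$ be finite sets, $P_{A,E}$ a probability distribution on $\mathcal A\times\mathcal E$, and $p(n)$ a polynomial taking positive values at positive integers. Then for every $R\ge H(A|E|P_{A,E})$, $$\lim_{n\to\infty}\frac1n\,\underline\Delta_{I,\min}(\lceil e^{nR}\rceil,p(n)|P_{A,E}^n)=R-H(A|E|P_{A,E}).$$
   Context: Logarithms are natural. $P_{A,E}^n$ is the $n$-fold i.i.d. product distribution on $\mathcal A^n\times\mathcal E^n$; $H(A|E|P_{A,E})$ is the conditional Shannon entropy. A sub-distribution is a nonnegative function with total sum $\le1$; $P_E(e)=\sum_aP_{A,E}(a,e)$; $\|\cdot\|_1$ is the sum of absolute values; $\eta(x,y)=xy-x\log x$ with $\eta(0,y)=0$. $H_{\min}(A|E|P'\|P_E)\ge r$ means $P'(a,e)\le e^{-r}P_E(e)$ for all $(a,e)$. With the minimum over $r$ understood as an infimum, $$\underline\Delta_{I,\min}(\mathsf M,\varepsilon|P_{A,E})=\min_{r\in\mathbb R}\Bigl[\eta\Bigl(\min_{P'_{A,E}:\,P'_E\le P_E,\ H_{\min}(A|E|P'_{A,E}\|P_E)\ge r}\|P_{A,E}-P'_{A,E}\|_1,\ \log\mathsf M\Bigr)+\log\bigl(1+\varepsilon\mathsf M e^{-r}\bigr)\Bigr],$$ where $P'_{A,E}$ ranges over sub-distributions on $\mathcal A\times\mathcal E$ (and correspondingly on $\mathcal A^n\times\mathcal E^n$ for $P_{A,E}^n$). *)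

theory Defs
  imports "HOL-Probability.Probability" "HOL-Computational_Algebra.Polynomial"
begin

text \<open>
  \<open>H(A|E|P)\<close> for a distribution on the product of two finite alphabets (types of class
  \<open>finite\<close>), in nats: the library's conditional entropy to base \<open>e\<close> of the first
  coordinate given the second. The lemma \<open>cond_entropy_eq_sum\<close> below gives the usual finite sum.
\<close>

definition cond_entropy :: "('a::finite \<times> 'e::finite) pmf \<Rightarrow> real" where
  "cond_entropy P =
     prob_space.conditional_entropy (measure_pmf P) (exp 1) (count_space UNIV) (count_space UNIV) fst snd"

text \<open>
  \<open>P\<close> to the power \<open>n\<close> as a distribution on pairs of words in \<open>A\<^sup>n \<times> E\<^sup>n\<close>, words being lists of
  length \<open>n\<close>.
\<close>

definition words :: "nat \<Rightarrow> 'a list set" where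
  "words n = {xs. length xs = n}"

definition iid_pmf :: "nat \<Rightarrow> ('a \<times> 'e) pmf \<Rightarrow> ('a list \<times> 'e list) pmf" where
  "iid_pmf n P = map_pmf (\<lambda>xs. (map fst xs, map snd xs)) (replicate_pmf n P)"

text \<open>
  From here on \<open>A\<close> and \<open>E\<close> are explicit finite carriers, so that the same definitions apply to
  \<open>A\<^sup>n\<close> and \<open>E\<^sup>n\<close> for varying \<open>n\<close>. Sub-distributions on \<open>A \<times> E\<close> are represented by
  functions whose values outside \<open>A \<times> E\<close> are irrelevant.
\<close>

definition sub_distributions :: "'a set \<Rightarrow> 'e set \<Rightarrow> ('a \<times> 'e \<Rightarrow> real) set" where
  "sub_distributions A E = {Q. (\<forall>x\<in>A \<times> E. 0 \<le> Q x) \<and> (\<Sum>x\<in>A \<times> E. Q x) \<le> 1}"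

definition marginal_E :: "'a set \<Rightarrow> ('a \<times> 'e \<Rightarrow> real) \<Rightarrow> 'e \<Rightarrow> real" where
  "marginal_E A Q e = (\<Sum>a\<in>A. Q (a, e))"

text \<open>\<open>Hmin_ge A E Q S r\<close> stands for \<open>H\<^sub>m\<^sub>i\<^sub>n(A|E|Q\<parallel>S) \<ge> r\<close>.\<close>

definition Hmin_ge ::
    "'a set \<Rightarrow> 'e set \<Rightarrow> ('a \<times> 'e \<Rightarrow> real) \<Rightarrow> ('e \<Rightarrow> real) \<Rightarrow> real \<Rightarrow> bool" where
  "Hmin_ge A E Q S r \<longleftrightarrow> (\<forall>a\<in>A. \<forall>e\<in>E. Q (a, e) \<le> exp (- r) * S e)"

definition l1_dist :: "'x set \<Rightarrow> ('x \<Rightarrow> real) \<Rightarrow> ('x \<Rightarrow> real) \<Rightarrow> real" where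
  "l1_dist X f g = (\<Sum>x\<in>X. \<bar>f x - g x\<bar>)"

definition eta :: "real \<Rightarrow> real \<Rightarrow> real" where
  "eta x y = (if x = 0 then 0 else x * y - x * ln x)"

definition smoothing_candidates ::
    "'a set \<Rightarrow> 'e set \<Rightarrow> ('a \<times> 'e) pmf \<Rightarrow> real \<Rightarrow> ('a \<times> 'e \<Rightarrow> real) set" where
  "smoothing_candidates A E P r =
     {Q \<in> sub_distributions A E.
        (\<forall>e\<in>E. marginal_E A Q e \<le> marginal_E A (pmf P) e) \<and>
        Hmin_ge A E Q (marginal_E A (pmf P)) r}"

text \<open>
  The zero function is always a candidate, so this infimum lies in \<open>[0, 1]\<close> when \<open>P\<close> is supported
  in \<open>A \<times> E\<close>; it is a minimum, by compactness.
\<close>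

definition smoothing_dist :: "'a set \<Rightarrow> 'e set \<Rightarrow> ('a \<times> 'e) pmf \<Rightarrow> real \<Rightarrow> real" where
  "smoothing_dist A E P r = (INF Q\<in>smoothing_candidates A E P r. l1_dist (A \<times> E) (pmf P) Q)"

text \<open>For \<open>M \<ge> 1\<close> and \<open>\<epsilon> \<ge> 0\<close> the set of values under the infimum is bounded below by \<open>0\<close>.\<close>

definition Delta_I_min :: "'a set \<Rightarrow> 'e set \<Rightarrow> nat \<Rightarrow> real \<Rightarrow> ('a \<times> 'e) pmf \<Rightarrow> real" where
  "Delta_I_min A E M \<epsilon> P =
     (INF r. eta (smoothing_dist A E P r) (ln (real M)) + ln (1 + \<epsilon> * real M * exp (- r)))"

lemma cond_entropy_eq_sum:
  fixes P :: "('a::finite \<times> 'e::finite) pmf"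
  shows "cond_entropy P =
           - (\<Sum>(a, e)\<in>UNIV. pmf P (a, e) * ln (pmf P (a, e) / marginal_E UNIV (pmf P) e))"
proof -
  interpret information_space "measure_pmf P" "exp 1"
    by unfold_locales simp
  have Y: "simple_distributed (measure_pmf P) snd (marginal_E UNIV (pmf P))"
  proof (rule measure_pmf.simple_distributedI)
    fix e :: 'e
    have "measure_pmf.prob P (snd -` {e}) = (\<Sum>x\<in>snd -` {e}. pmf P x)"
      by (rule measure_measure_pmf_finite) simp
    also have "\<dots> = (\<Sum>x\<in>range (\<lambda>a::'a. (a, e)). pmf P x)"
      by (rule sum.cong) auto
    also have "(\<Sum>x\<in>range (\<lambda>a. (a, e)). pmf P x) = marginal_E UNIV (pmf P) e"
      by (subst sum.reindex) (auto simp: inj_on_def marginal_E_def)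
    finally show "marginal_E UNIV (pmf P) e
        = measure_pmf.prob P (snd -` {e} \<inter> space (measure_pmf P))" by simp
  qed (auto simp: simple_function_def marginal_E_def sum_nonneg)
  have XY: "simple_distributed (measure_pmf P) (\<lambda>x. (fst x, snd x)) (pmf P)"
    by (rule measure_pmf.simple_distributedI)
       (auto simp: simple_function_def pmf.rep_eq intro: arg_cong[where f = "measure_pmf.prob P"])
  show ?thesis
    using conditional_entropy_eq[OF Y XY] by (simp add: cond_entropy_def log_def)
qed

lemma pmf_iid_pmf:
  assumes "length xs = n" "length ys = n"
  shows "pmf (iid_pmf n P) (xs, ys) = (\<Prod>i<n. pmf P (xs ! i, ys ! i))"
proof -
  have rep: "pmf (replicate_pmf (length zs) P) zs = (\<Prod>i<length zs. pmf P (zs ! i))" for zs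
  proof (induction zs)
    case (Cons z zs)
    have "replicate_pmf (Suc (length zs)) P =
        map_pmf (\<lambda>(x, xs). x # xs) (pair_pmf P (replicate_pmf (length zs) P))"
      by (simp add: pair_pmf_def map_bind_pmf)
    moreover have "pmf (map_pmf (\<lambda>(x, xs). x # xs) (pair_pmf P (replicate_pmf (length zs) P)))
          ((\<lambda>(x, xs). x # xs) (z, zs)) = pmf (pair_pmf P (replicate_pmf (length zs) P)) (z, zs)"
      by (rule pmf_map_inj') (auto simp: inj_def)
    ultimately show ?case
      using Cons by (simp add: pmf_pair prod.lessThan_Suc_shift del: prod.lessThan_Suc)
  qed simp
  have inj: "inj (\<lambda>zs::('a \<times> 'b) list. (map fst zs, map snd zs))"
    by (rule injI) (metis zip_map_fst_snd Pair_inject)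
  have "pmf (iid_pmf n P) (xs, ys) = pmf (replicate_pmf n P) (zip xs ys)"
    using pmf_map_inj'[OF inj, of "replicate_pmf n P" "zip xs ys"] assms
    by (simp add: iid_pmf_def)
  also have "\<dots> = (\<Prod>i<n. pmf P (xs ! i, ys ! i))"
    using rep[of "zip xs ys"] assms by simp
  finally show ?thesis .
qed

end

theory Submission
  imports Defs "HOL-Real_Asymp.Real_Asymp"
begin

text \<open>
  By Chebyshev's inequality, \<open>- log P\<^sup>n(a|e)\<close> is within \<open>n \<delta>\<close> of \<open>n H\<close> outside an event of
  probability \<open>O(1/n)\<close>. For \<open>r = n (H - \<delta>)\<close> the restriction of \<open>P\<^sup>n\<close> to the typical pairs is
  therefore an admissible smoothing at vanishing distance, and the logarithmic term is
  \<open>n (R - H + \<delta>) + O(log n)\<close>. Conversely, if \<open>r\<close> is at most \<open>n (H + 2 \<delta>)\<close> the logarithmic term alone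
  is at least \<open>n (R - H - 2 \<delta>) + O(1)\<close>; for larger \<open>r\<close> an admissible smoothing carries only an
  exponentially small part of the typical mass, so the distance tends to \<open>1\<close> and \<open>\<eta>\<close> is about
  \<open>n R \<ge> n (R - H)\<close>.
\<close>

section \<open>One-shot bounds\<close>

text \<open>Used for i.i.d. words: seen as a push-forward under \<open>snd\<close>, the marginal
  commutes with taking powers.\<close>

lemma marginal_E_pmf:
  assumes "finite A" "set_pmf Q \<subseteq> A \<times> UNIV"
  shows "marginal_E A (pmf Q) e = pmf (map_pmf snd Q) e"
proof -
  have "pmf (map_pmf snd Q) e = measure_pmf.prob Q (snd -` {e})"
    by (simp add: pmf_map)
  also have "\<dots> = measure_pmf.prob Q ((\<lambda>a. (a, e)) ` A)"
    by (rule measure_prob_cong_0) (use assms(2) in \<open>force simp: set_pmf_eq\<close>)+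
  also have "\<dots> = marginal_E A (pmf Q) e"
    using assms(1) by (simp add: measure_measure_pmf_finite sum.reindex inj_on_def marginal_E_def)
  finally show ?thesis ..
qed

text \<open>On the unit interval \<open>- x * ln x\<close> is nonnegative.\<close>

lemma mult_le_eta:
  assumes "0 \<le> x" "x \<le> 1"
  shows "x * y \<le> eta x y"
proof (cases "x = 0")
  case False
  then have "x * ln x \<le> 0"
    using assms by (intro mult_nonneg_nonpos) auto
  then show ?thesis using False by (simp add: eta_def)
qed (simp add: eta_def)

text \<open>The entropy part \<open>- x * ln x\<close> is at most 1, by ln z \<le> z - 1 at z = 1 /
  x. The constant vanishes after division by n.\<close>

lemma eta_le:
  assumes "0 \<le> x"
  shows "eta x y \<le> x * y + 1"
proof (cases "x = 0")
  case False
  then have "x > 0" using assms by simp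
  then have "- ln x \<le> 1 / x"
    using ln_le_minus_one[of "1 / x"] by (simp add: ln_div)
  then have "x * (- ln x) \<le> x * (1 / x)"
    using \<open>x > 0\<close> by (intro mult_left_mono) auto
  then show ?thesis using \<open>x > 0\<close> by (simp add: eta_def)
qed (simp add: eta_def)

text \<open>To be interpreted with \<open>words n\<close> for both carriers: the type of lists is
  infinite, so finiteness is imposed on carriers that contain the support.\<close>

locale finite_pair_pmf =
  fixes A :: "'a set" and E :: "'e set" and Q :: "('a \<times> 'e) pmf"
  assumes finite_A: "finite A" and finite_E: "finite E" and supp: "set_pmf Q \<subseteq> A \<times> E"
begin

abbreviation "QE \<equiv> marginal_E A (pmf Q)"

lemma QE_nonneg: "0 \<le> QE e"
  by (simp add: marginal_E_def sum_nonneg)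

lemma sum_pmf: "(\<Sum>x\<in>A \<times> E. pmf Q x) = 1"
  by (rule sum_pmf_eq_1) (use finite_A finite_E supp in auto)

lemma prob_eq_sum: "measure_pmf.prob Q T = (\<Sum>x\<in>A \<times> E. if x \<in> T then pmf Q x else 0)"
proof -
  have "measure_pmf.prob Q T = measure_pmf.prob Q ((A \<times> E) \<inter> T)"
    by (rule measure_prob_cong_0) (use supp in \<open>auto simp: set_pmf_eq\<close>)
  then show ?thesis
    using finite_A finite_E by (simp add: measure_measure_pmf_finite sum.inter_restrict)
qed

text \<open>Setting entries to 0 only lowers total mass and marginal, and the min-entropy bound is
  trivial where the value is 0. The empty \<open>T\<close> gives the zero candidate.\<close>

lemma truncation_is_candidate:
  assumes "\<And>a e. (a, e) \<in> T \<Longrightarrow> pmf Q (a, e) \<le> exp (- r) * QE e"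
  shows "(\<lambda>x. if x \<in> T then pmf Q x else 0) \<in> smoothing_candidates A E Q r"
proof -
  have "(\<Sum>x\<in>A \<times> E. if x \<in> T then pmf Q x else 0) \<le> (\<Sum>x\<in>A \<times> E. pmf Q x)"
    by (rule sum_mono) auto
  moreover have "marginal_E A (\<lambda>x. if x \<in> T then pmf Q x else 0) e \<le> QE e" for e
    unfolding marginal_E_def by (rule sum_mono) auto
  ultimately show ?thesis
    using assms sum_pmf QE_nonneg
    by (auto simp: smoothing_candidates_def sub_distributions_def Hmin_ge_def)
qed

lemma bdd_below_l1: "bdd_below ((\<lambda>S. l1_dist (A \<times> E) (pmf Q) S) ` C)"
  by (rule bdd_belowI[of _ 0]) (auto simp: l1_dist_def intro!: sum_nonneg)

lemma candidates_nonempty: "smoothing_candidates A E Q r \<noteq> {}"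
  using truncation_is_candidate[of "{}" r] by auto

lemma smoothing_dist_nonneg: "0 \<le> smoothing_dist A E Q r"
  unfolding smoothing_dist_def
  by (rule cINF_greatest[OF candidates_nonempty]) (auto simp: l1_dist_def intro!: sum_nonneg)

text \<open>Deleting exactly the entries that violate the min-entropy bound costs their total
  mass.\<close>

lemma smoothing_dist_le_prob:
  "smoothing_dist A E Q r \<le> measure_pmf.prob Q {(a, e). pmf Q (a, e) > exp (- r) * QE e}"
proof -
  define T where "T = {(a, e). pmf Q (a, e) \<le> exp (- r) * QE e}"
  have "smoothing_dist A E Q r \<le> l1_dist (A \<times> E) (pmf Q) (\<lambda>x. if x \<in> T then pmf Q x else 0)"
    unfolding smoothing_dist_def
    by (rule cINF_lower[OF bdd_below_l1 truncation_is_candidate]) (auto simp: T_def)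
  also have "\<dots> = measure_pmf.prob Q {(a, e). pmf Q (a, e) > exp (- r) * QE e}"
    unfolding prob_eq_sum l1_dist_def T_def by (intro sum.cong) auto
  finally show ?thesis .
qed

lemma smoothing_dist_le_1: "smoothing_dist A E Q r \<le> 1"
  using smoothing_dist_le_prob measure_pmf.prob_le_1 order_trans by blast

text \<open>Informative for t < r: where \<open>pmf Q\<close> is at least exp (- t) times the
  marginal, a candidate, capped at exp (- r) times the marginal, keeps at most the fraction exp (t -
  r) of \<open>pmf Q\<close>.\<close>

lemma prob_le_smoothing_dist:
  "measure_pmf.prob Q {(a, e). pmf Q (a, e) \<ge> exp (- t) * QE e} - exp (t - r) \<le> smoothing_dist A E Q r"
  unfolding smoothing_dist_def
proof (rule cINF_greatest[OF candidates_nonempty])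
  fix S assume S: "S \<in> smoothing_candidates A E Q r"
  define T where "T = {(a, e). pmf Q (a, e) \<ge> exp (- t) * QE e}"
  \<comment> \<open>Subtracting the fraction off \<open>T\<close> as well only weakens the bound,
    and the subtracted terms then sum to exactly exp (t - r).\<close>
  have "(if x \<in> T then pmf Q x else 0) - exp (t - r) * pmf Q x \<le> \<bar>pmf Q x - S x\<bar>"
    if "x \<in> A \<times> E" for x
  proof (cases "x \<in> T")
    case True
    obtain a e where x: "x = (a, e)" by force
    have "S x \<le> exp (- r) * QE e"
      using S that by (auto simp: x smoothing_candidates_def Hmin_ge_def)
    also have "\<dots> = exp (t - r) * (exp (- t) * QE e)"
      by (simp flip: exp_add mult.assoc)
    also have "\<dots> \<le> exp (t - r) * pmf Q x"
      using True by (intro mult_left_mono) (auto simp: T_def x)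
    finally show ?thesis using True by simp
  next
    case False
    have "0 \<le> exp (t - r) * pmf Q x" by simp
    then have "0 - exp (t - r) * pmf Q x \<le> \<bar>pmf Q x - S x\<bar>" by linarith
    then show ?thesis using False by simp
  qed
  then have "(\<Sum>x\<in>A \<times> E. (if x \<in> T then pmf Q x else 0) - exp (t - r) * pmf Q x)
      \<le> l1_dist (A \<times> E) (pmf Q) S"
    unfolding l1_dist_def by (rule sum_mono)
  then show "measure_pmf.prob Q {(a, e). pmf Q (a, e) \<ge> exp (- t) * QE e} - exp (t - r)
      \<le> l1_dist (A \<times> E) (pmf Q) S"
    unfolding T_def[symmetric] by (simp add: sum_subtractf prob_eq_sum sum_pmf flip: sum_distrib_left)
qed

section \<open>Bounds on the infimum over r\<close>

text \<open>The infimum is at most its value at any single r; there the smoothing distance is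
  bounded by truncation.\<close>

lemma Delta_I_min_le:
  assumes "M \<ge> 1" "\<epsilon> \<ge> 0"
    and s: "measure_pmf.prob Q {(a, e). pmf Q (a, e) > exp (- r) * QE e} \<le> s"
  shows "Delta_I_min A E M \<epsilon> Q \<le> s * ln (real M) + 1 + ln (1 + \<epsilon> * real M * exp (- r))"
proof -
  have M: "0 \<le> ln (real M)" using assms(1) by simp
  have "Delta_I_min A E M \<epsilon> Q
      \<le> eta (smoothing_dist A E Q r) (ln (real M)) + ln (1 + \<epsilon> * real M * exp (- r))"
    unfolding Delta_I_min_def
  proof (rule cINF_lower)
    \<comment> \<open>A real infimum lies below its members only if the set is bounded below. Both
      summands are nonnegative, since the distance is in [0, 1], M \<ge> 1 and \<epsilon> \<ge>
      0.\<close>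
    have "0 \<le> eta (smoothing_dist A E Q r) (ln (real M)) + ln (1 + \<epsilon> * real M * exp (- r))" for r
      using mult_le_eta[OF smoothing_dist_nonneg smoothing_dist_le_1, of r "ln (real M)"]
        mult_nonneg_nonneg[OF smoothing_dist_nonneg M, of r] assms(2)
      by (smt (verit) ln_ge_zero mult_nonneg_nonneg exp_ge_zero of_nat_0_le_iff)
    then show "bdd_below (range (\<lambda>r. eta (smoothing_dist A E Q r) (ln (real M))
        + ln (1 + \<epsilon> * real M * exp (- r))))"
      by (intro bdd_belowI[of _ 0]) auto
  qed simp
  also have "eta (smoothing_dist A E Q r) (ln (real M)) \<le> smoothing_dist A E Q r * ln (real M) + 1"
    by (rule eta_le[OF smoothing_dist_nonneg])
  also have "smoothing_dist A E Q r * ln (real M) \<le> s * ln (real M)"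
    using smoothing_dist_le_prob[of r] s M by (intro mult_right_mono) auto
  finally show ?thesis by simp
qed

text \<open>Values of \<open>r\<close> above \<open>u\<close> are charged to the smoothing term, the others to the logarithmic one.\<close>

lemma Delta_I_min_ge:
  assumes "M \<ge> 1" "\<epsilon> > 0"
    and s: "s \<le> measure_pmf.prob Q {(a, e). pmf Q (a, e) \<ge> exp (- t) * QE e}"
  shows "min ((s - exp (t - u)) * ln (real M)) (ln \<epsilon> + ln (real M) - u) \<le> Delta_I_min A E M \<epsilon> Q"
  unfolding Delta_I_min_def
proof (rule cINF_greatest)
  fix r :: real
  have M: "0 \<le> ln (real M)" "0 < real M" using assms(1) by auto
  have 0: "smoothing_dist A E Q r * ln (real M) \<le> eta (smoothing_dist A E Q r) (ln (real M))"
    by (rule mult_le_eta[OF smoothing_dist_nonneg smoothing_dist_le_1])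
  have 1: "0 \<le> smoothing_dist A E Q r * ln (real M)"
    by (rule mult_nonneg_nonneg[OF smoothing_dist_nonneg M(1)])
  have pos: "0 < \<epsilon> * real M * exp (- r)" using M assms(2) by simp
  show "min ((s - exp (t - u)) * ln (real M)) (ln \<epsilon> + ln (real M) - u)
      \<le> eta (smoothing_dist A E Q r) (ln (real M)) + ln (1 + \<epsilon> * real M * exp (- r))"
  proof (cases "r \<le> u")
    case True
    \<comment> \<open>Dropping the 1 inside the logarithm leaves a bound that decreases in r, hence
      is smallest at r = u.\<close>
    have "ln \<epsilon> + ln (real M) - r = ln (\<epsilon> * real M * exp (- r))"
      using M assms(2) by (simp add: ln_mult)
    also have "\<dots> \<le> ln (1 + \<epsilon> * real M * exp (- r))"
      using pos by simp
    finally show ?thesis using 0 1 True by linarith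
  next
    case False
    then have "exp (t - r) \<le> exp (t - u)" by simp
    then have "s - exp (t - u) \<le> smoothing_dist A E Q r"
      using prob_le_smoothing_dist[of t r] s by linarith
    then have "(s - exp (t - u)) * ln (real M) \<le> smoothing_dist A E Q r * ln (real M)"
      using M by (intro mult_right_mono)
    moreover have "0 \<le> ln (1 + \<epsilon> * real M * exp (- r))" using pos by simp
    ultimately show ?thesis using 0 by linarith
  qed
qed simp

end

section \<open>Asymptotic equipartition\<close>

lemma replicate_pmf_Suc_pair:
  "replicate_pmf (Suc n) p = map_pmf (\<lambda>(x, xs). x # xs) (pair_pmf p (replicate_pmf n p))"
  by (simp add: pair_pmf_def map_bind_pmf)

lemma map_replicate_pmf:
  "map_pmf (map f) (replicate_pmf n p) = replicate_pmf n (map_pmf f p)"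
proof (induction n)
  case (Suc n)
  show ?case
    by (simp add: map_bind_pmf bind_map_pmf flip: Suc.IH)
qed simp

lemma pmf_replicate_pmf:
  "length xs = n \<Longrightarrow> pmf (replicate_pmf n p) xs = (\<Prod>x\<leftarrow>xs. pmf p x)"
proof (induction xs arbitrary: n)
  case (Cons x xs)
  have "pmf (map_pmf (\<lambda>(x, xs). x # xs) (pair_pmf p (replicate_pmf (length xs) p))) (case (x, xs) of (x, xs) \<Rightarrow> x # xs)
      = pmf (pair_pmf p (replicate_pmf (length xs) p)) (x, xs)"
    by (rule pmf_map_inj') (auto simp: inj_def)
  then show ?case
    using Cons by (auto simp: pmf_pair simp flip: replicate_pmf_Suc_pair simp del: replicate_pmf.simps)
qed simp

text \<open>Finite support makes every real function integrable, as linearity of the expectation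
  requires below.\<close>

lemma finite_set_replicate_pmf: "finite (set_pmf p) \<Longrightarrow> finite (set_pmf (replicate_pmf n p))"
  using finite_lists_length_eq[of "set_pmf p" n]
  by (simp add: set_replicate_pmf lists_eq_set conj_commute Collect_conj_eq Int_commute)

text \<open>Conditioning on the first letter; this drives the inductions for the first and second
  moments.\<close>

lemma expectation_replicate_Suc:
  fixes h :: "'a list \<Rightarrow> real"
  assumes "finite (set_pmf p)"
  shows "measure_pmf.expectation (replicate_pmf (Suc n) p) h =
    measure_pmf.expectation p (\<lambda>x. measure_pmf.expectation (replicate_pmf n p) (\<lambda>xs. h (x # xs)))"
proof -
  have "measure_pmf.expectation (replicate_pmf (Suc n) p) h =
    (\<Sum>x\<in>set_pmf p. pmf p x *\<^sub>R measure_pmf.expectation (map_pmf ((#) x) (replicate_pmf n p)) h)"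
    unfolding replicate_pmf.simps map_pmf_def[symmetric]
    by (rule pmf_expectation_bind) (use assms finite_set_replicate_pmf[OF assms] in auto)
  also have "\<dots> = measure_pmf.expectation p (\<lambda>x. measure_pmf.expectation (replicate_pmf n p) (\<lambda>xs. h (x # xs)))"
    by (subst integral_measure_pmf_real[OF assms]) (auto simp: mult.commute)
  finally show ?thesis .
qed

lemma expectation_sum_list_replicate_pmf:
  fixes g :: "'a \<Rightarrow> real"
  assumes fin: "finite (set_pmf p)" and centered: "measure_pmf.expectation p g = 0"
  shows "measure_pmf.expectation (replicate_pmf n p) (\<lambda>xs. \<Sum>x\<leftarrow>xs. g x) = 0"
proof (induction n)
  case (Suc n)
  note [simp] = integrable_measure_pmf_finite[OF fin]
    integrable_measure_pmf_finite[OF finite_set_replicate_pmf[OF fin]]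
  show ?case
    using Suc centered
    by (simp add: expectation_replicate_Suc[OF fin] del: replicate_pmf.simps)
qed simp

text \<open>After expanding the square, the cross term vanishes because the sum over the remaining
  letters has mean 0.\<close>

lemma second_moment_sum_list_replicate_pmf:
  fixes g :: "'a \<Rightarrow> real"
  assumes fin: "finite (set_pmf p)" and centered: "measure_pmf.expectation p g = 0"
  shows "measure_pmf.expectation (replicate_pmf n p) (\<lambda>xs. (\<Sum>x\<leftarrow>xs. g x)\<^sup>2)
    = real n * measure_pmf.expectation p (\<lambda>x. (g x)\<^sup>2)"
proof (induction n)
  case (Suc n)
  note [simp] = integrable_measure_pmf_finite[OF fin]
    integrable_measure_pmf_finite[OF finite_set_replicate_pmf[OF fin]]
  have "measure_pmf.expectation (replicate_pmf n p) (\<lambda>xs. (g x + (\<Sum>x\<leftarrow>xs. g x))\<^sup>2)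
      = (g x)\<^sup>2 + real n * measure_pmf.expectation p (\<lambda>x. (g x)\<^sup>2)" for x
    using Suc expectation_sum_list_replicate_pmf[OF assms, of n]
    by (simp add: power2_sum mult.assoc)
  then show ?case
    by (simp add: expectation_replicate_Suc[OF fin] algebra_simps del: replicate_pmf.simps)
qed simp

text \<open>Chebyshev's inequality, as Markov's inequality for the square of the sum.\<close>

lemma prob_sum_list_replicate_pmf:
  fixes g :: "'a \<Rightarrow> real"
  assumes fin: "finite (set_pmf p)" and centered: "measure_pmf.expectation p g = 0"
    and "\<delta> > 0" "n > 0"
  shows "measure_pmf.prob (replicate_pmf n p) {xs. \<bar>\<Sum>x\<leftarrow>xs. g x\<bar> \<ge> real n * \<delta>}
    \<le> measure_pmf.expectation p (\<lambda>x. (g x)\<^sup>2) / (real n * \<delta>\<^sup>2)"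
proof -
  have "{xs. \<bar>\<Sum>x\<leftarrow>xs. g x\<bar> \<ge> real n * \<delta>} = {xs. (\<Sum>x\<leftarrow>xs. g x)\<^sup>2 \<ge> (real n * \<delta>)\<^sup>2}"
    using assms(3) by (auto simp: abs_le_square_iff[symmetric])
  also have "measure_pmf.prob (replicate_pmf n p) \<dots>
      \<le> measure_pmf.expectation (replicate_pmf n p) (\<lambda>xs. (\<Sum>x\<leftarrow>xs. g x)\<^sup>2) / (real n * \<delta>)\<^sup>2"
    using integral_Markov_inequality_measure[of "measure_pmf (replicate_pmf n p)"
        "\<lambda>xs. (\<Sum>x\<leftarrow>xs. g x)\<^sup>2" "{}" "(real n * \<delta>)\<^sup>2"] assms
    by (simp add: integrable_measure_pmf_finite[OF finite_set_replicate_pmf[OF fin]])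
  also have "\<dots> = measure_pmf.expectation p (\<lambda>x. (g x)\<^sup>2) / (real n * \<delta>\<^sup>2)"
    using assms(4) unfolding second_moment_sum_list_replicate_pmf[OF fin centered]
    by (simp add: power_mult_distrib power2_eq_square[of "real n"])
  finally show ?thesis .
qed

section \<open>Conditional information of i.i.d. pairs\<close>

lemma iid_finite_pair_pmf:
  fixes P :: "('a::finite \<times> 'e::finite) pmf"
  shows "finite_pair_pmf (words n) (words n) (iid_pmf n P)"
proof
  show "finite (words n :: 'a list set)" "finite (words n :: 'e list set)"
    using finite_lists_length_eq[OF finite[of "UNIV :: 'a set"], of n]
      finite_lists_length_eq[OF finite[of "UNIV :: 'e set"], of n]
    by (simp_all add: words_def)
qed (auto simp: iid_pmf_def words_def set_replicate_pmf)

text \<open>The second components of an i.i.d. word of pairs again form an i.i.d. word, so the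
  marginal factorizes.\<close>

lemma marginal_E_iid_pmf:
  fixes P :: "('a::finite \<times> 'e::finite) pmf"
  assumes "length ys = n"
  shows "marginal_E (words n) (pmf (iid_pmf n P)) ys = (\<Prod>y\<leftarrow>ys. marginal_E UNIV (pmf P) y)"
proof -
  interpret finite_pair_pmf "words n" "words n" "iid_pmf n P" by (rule iid_finite_pair_pmf)
  have "marginal_E (words n) (pmf (iid_pmf n P)) ys = pmf (map_pmf snd (iid_pmf n P)) ys"
    using supp by (intro marginal_E_pmf[OF finite_A]) auto
  also have "map_pmf snd (iid_pmf n P) = replicate_pmf n (map_pmf snd P)"
    by (simp add: iid_pmf_def map_pmf_comp flip: map_replicate_pmf)
  finally show ?thesis using assms by (simp add: pmf_replicate_pmf marginal_E_pmf)
qed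

text \<open>The pointwise surprisal - log P(a|e), whose mean is the conditional entropy. Values off
  the support have weight 0 in expectations.\<close>

definition cond_info :: "('a::finite \<times> 'e::finite) pmf \<Rightarrow> 'a \<times> 'e \<Rightarrow> real" where
  "cond_info P x = - ln (pmf P x / marginal_E UNIV (pmf P) (snd x))"

lemma expectation_cond_info: "measure_pmf.expectation P (cond_info P) = cond_entropy P"
  by (subst integral_measure_pmf_real[of UNIV])
    (auto simp: cond_entropy_eq_sum cond_info_def case_prod_beta mult.commute simp flip: sum_negf)

lemma pmf_eq_exp_cond_info:
  assumes "x \<in> set_pmf P"
  shows "pmf P x = exp (- cond_info P x) * marginal_E UNIV (pmf P) (snd x)"
proof -
  have "0 < pmf P x" using assms by (simp add: pmf_positive)
  \<comment> \<open>Hence the marginal is positive too, and logarithm and division can be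
    undone.\<close>
  moreover have "pmf P (fst x, snd x) \<le> marginal_E UNIV (pmf P) (snd x)"
    unfolding marginal_E_def by (rule member_le_sum) auto
  ultimately show ?thesis by (simp add: cond_info_def)
qed

text \<open>Turns a comparison of the joint mass with a multiple of the marginal into one for a sum
  of i.i.d. variables.\<close>

lemma pmf_iid_eq_exp_cond_info:
  fixes P :: "('a::finite \<times> 'e::finite) pmf"
  assumes "zs \<in> set_pmf (replicate_pmf n P)"
  shows "pmf (iid_pmf n P) (map fst zs, map snd zs) =
    exp (- (\<Sum>z\<leftarrow>zs. cond_info P z)) * marginal_E (words n) (pmf (iid_pmf n P)) (map snd zs)"
proof -
  have len: "length zs = n" and sub: "set zs \<subseteq> set_pmf P"
    using assms by (auto simp: set_replicate_pmf)
  have inj: "inj (\<lambda>zs::('a \<times> 'e) list. (map fst zs, map snd zs))"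
    by (rule injI) (metis zip_map_fst_snd Pair_inject)
  have "pmf (iid_pmf n P) (map fst zs, map snd zs) = (\<Prod>z\<leftarrow>zs. pmf P z)"
    using pmf_map_inj'[OF inj, of "replicate_pmf n P" zs] len
    by (simp add: iid_pmf_def pmf_replicate_pmf)
  also have "\<dots> = exp (- (\<Sum>z\<leftarrow>zs. cond_info P z)) * (\<Prod>z\<leftarrow>zs. marginal_E UNIV (pmf P) (snd z))"
    using sub by (induction zs) (simp_all add: pmf_eq_exp_cond_info exp_diff exp_minus field_simps)
  finally show ?thesis using len by (simp add: marginal_E_iid_pmf comp_def)
qed

text \<open>Chebyshev's inequality for the centered surprisal, whose variance is \<open>v\<close>.
  The event \<open>T\<close> is left general so that deviations on either side are covered.\<close>

lemma prob_iid_atypical: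
  fixes P :: "('a::finite \<times> 'e::finite) pmf"
  defines "v \<equiv> measure_pmf.expectation P (\<lambda>x. (cond_info P x - cond_entropy P)\<^sup>2)"
  assumes "\<delta> > 0" "n > 0"
    and T: "\<And>zs. zs \<in> set_pmf (replicate_pmf n P) \<Longrightarrow> (map fst zs, map snd zs) \<in> T \<Longrightarrow>
      \<bar>(\<Sum>z\<leftarrow>zs. cond_info P z) - real n * cond_entropy P\<bar> \<ge> real n * \<delta>"
  shows "measure_pmf.prob (iid_pmf n P) T \<le> v / (real n * \<delta>\<^sup>2)"
proof -
  let ?g = "\<lambda>x. cond_info P x - cond_entropy P"
  have fin: "finite (set_pmf P)" by simp
  have "measure_pmf.prob (iid_pmf n P) T
      = measure_pmf.prob (replicate_pmf n P) ((\<lambda>zs. (map fst zs, map snd zs)) -` T)"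
    by (simp add: iid_pmf_def)
  also have "\<dots> \<le> measure_pmf.prob (replicate_pmf n P) {zs. \<bar>\<Sum>z\<leftarrow>zs. ?g z\<bar> \<ge> real n * \<delta>}"
  proof (rule measure_pmf.finite_measure_mono_AE)
    \<comment> \<open>Inclusion almost everywhere is the right form: \<open>T\<close> is controlled
      only on the support.\<close>
    show "AE zs in replicate_pmf n P. zs \<in> (\<lambda>zs. (map fst zs, map snd zs)) -` T
        \<longrightarrow> zs \<in> {zs. \<bar>\<Sum>z\<leftarrow>zs. ?g z\<bar> \<ge> real n * \<delta>}"
      using T by (auto simp: AE_measure_pmf_iff sum_list_subtractf sum_list_triv set_replicate_pmf)
  qed simp
  also have "\<dots> \<le> v / (real n * \<delta>\<^sup>2)"
    unfolding v_def using assms(2,3)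
    by (intro prob_sum_list_replicate_pmf)
      (auto simp: expectation_cond_info integrable_measure_pmf_finite[OF fin])
  finally show ?thesis .
qed

text \<open>Strictness of the first hypothesis excludes m = 0.\<close>

lemma exp_mult_less_cancel:
  fixes m :: real
  assumes "exp x * m < exp y * m" "0 \<le> m"
  shows "x < y"
  using assms by (simp add: mult_less_cancel_right_disj)

text \<open>In this event the surprisal sum lies below its mean by more than n \<delta>.\<close>

lemma prob_iid_above_marginal:
  fixes P :: "('a::finite \<times> 'e::finite) pmf"
  assumes "\<delta> > 0" "n > 0"
  shows "measure_pmf.prob (iid_pmf n P) {(a, e). pmf (iid_pmf n P) (a, e) >
      exp (- (real n * (cond_entropy P - \<delta>))) * marginal_E (words n) (pmf (iid_pmf n P)) e}
    \<le> measure_pmf.expectation P (\<lambda>x. (cond_info P x - cond_entropy P)\<^sup>2) / (real n * \<delta>\<^sup>2)"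
proof (rule prob_iid_atypical[OF assms])
  interpret finite_pair_pmf "words n" "words n" "iid_pmf n P" by (rule iid_finite_pair_pmf)
  fix zs
  assume "zs \<in> set_pmf (replicate_pmf n P)" and "(map fst zs, map snd zs) \<in>
    {(a, e). pmf (iid_pmf n P) (a, e) > exp (- (real n * (cond_entropy P - \<delta>))) * QE e}"
  then have "exp (- (real n * (cond_entropy P - \<delta>))) * QE (map snd zs)
      < exp (- (\<Sum>z\<leftarrow>zs. cond_info P z)) * QE (map snd zs)"
    by (simp add: pmf_iid_eq_exp_cond_info)
  then have "- (real n * (cond_entropy P - \<delta>)) < - (\<Sum>z\<leftarrow>zs. cond_info P z)"
    by (rule exp_mult_less_cancel[OF _ QE_nonneg])
  then show "real n * \<delta> \<le> \<bar>(\<Sum>z\<leftarrow>zs. cond_info P z) - real n * cond_entropy P\<bar>"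
    unfolding right_diff_distrib by linarith
qed

text \<open>In the complementary event the surprisal sum exceeds its mean by more than n
  \<delta>.\<close>

lemma prob_iid_below_marginal:
  fixes P :: "('a::finite \<times> 'e::finite) pmf"
  assumes "\<delta> > 0" "n > 0"
  shows "1 - measure_pmf.expectation P (\<lambda>x. (cond_info P x - cond_entropy P)\<^sup>2) / (real n * \<delta>\<^sup>2)
    \<le> measure_pmf.prob (iid_pmf n P) {(a, e). pmf (iid_pmf n P) (a, e) \<ge>
      exp (- (real n * (cond_entropy P + \<delta>))) * marginal_E (words n) (pmf (iid_pmf n P)) e}"
    (is "1 - ?b \<le> measure_pmf.prob ?Q ?T")
proof -
  interpret finite_pair_pmf "words n" "words n" "iid_pmf n P" by (rule iid_finite_pair_pmf)
  have "measure_pmf.prob ?Q (- ?T) \<le> ?b"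
  proof (rule prob_iid_atypical[OF assms])
    fix zs
    assume "zs \<in> set_pmf (replicate_pmf n P)" and "(map fst zs, map snd zs) \<in> - ?T"
    then have "exp (- (\<Sum>z\<leftarrow>zs. cond_info P z)) * QE (map snd zs)
        < exp (- (real n * (cond_entropy P + \<delta>))) * QE (map snd zs)"
      by (simp add: pmf_iid_eq_exp_cond_info not_le)
    then have "- (\<Sum>z\<leftarrow>zs. cond_info P z) < - (real n * (cond_entropy P + \<delta>))"
      by (rule exp_mult_less_cancel[OF _ QE_nonneg])
    then show "real n * \<delta> \<le> \<bar>(\<Sum>z\<leftarrow>zs. cond_info P z) - real n * cond_entropy P\<bar>"
      unfolding distrib_left by linarith
  qed
  moreover have "measure_pmf.prob ?Q (- ?T) = 1 - measure_pmf.prob ?Q ?T"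
    using measure_pmf.prob_compl[of ?T ?Q] by (simp add: Compl_eq_Diff_UNIV)
  ultimately show ?thesis by linarith
qed

text \<open>A point mass is at most its marginal, so the surprisal is nonnegative on the support.
  This gives R \<ge> 0, hence exp (n R) \<ge> 1.\<close>

lemma cond_entropy_nonneg: "0 \<le> cond_entropy P"
proof -
  have "0 \<le> measure_pmf.expectation P (cond_info P)"
  proof (rule integral_nonneg_AE, unfold AE_measure_pmf_iff, rule ballI)
    fix x assume x: "x \<in> set_pmf P"
    have "pmf P (fst x, snd x) \<le> marginal_E UNIV (pmf P) (snd x)"
      unfolding marginal_E_def by (rule member_le_sum) auto
    then show "0 \<le> cond_info P x"
      using pmf_positive[OF x] by (simp add: cond_info_def)
  qed
  then show ?thesis by (simp add: expectation_cond_info)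
qed

section \<open>The limit\<close>

text \<open>For x \<ge> 1 each power is at most the top one. It makes ln p(n) at most O(log
  n).\<close>

lemma poly_upper_bound:
  fixes p :: "real poly"
  shows "\<exists>C\<ge>0. \<forall>x\<ge>1. poly p x \<le> C * x ^ degree p"
proof (intro exI[of _ "\<Sum>i\<le>degree p. \<bar>coeff p i\<bar>"] conjI allI impI)
  fix x :: real assume x: "1 \<le> x"
  have "coeff p i * x ^ i \<le> \<bar>coeff p i\<bar> * x ^ degree p" if "i \<le> degree p" for i
    using x that by (intro mult_mono power_increasing) auto
  then show "poly p x \<le> (\<Sum>i\<le>degree p. \<bar>coeff p i\<bar>) * x ^ degree p"
    by (auto simp: poly_altdef sum_distrib_right intro: sum_mono)
qed (simp add: sum_nonneg)

text \<open>A negative leading coefficient would make p negative at large integers, so it is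
  positive and eventually bounds p from below.\<close>

lemma poly_lower_bound:
  fixes p :: "real poly"
  assumes "\<And>n::nat. n \<ge> 1 \<Longrightarrow> poly p (real n) > 0"
  shows "\<exists>c>0. \<forall>\<^sub>F n in sequentially. c \<le> poly p (real n)"
proof -
  have "\<not> lead_coeff (- p) > 0"
  proof
    assume pos: "lead_coeff (- p) > 0"
    from poly_pinfty_gt_lc[OF this] obtain x0 where x0: "\<forall>x\<ge>x0. poly (- p) x \<ge> lead_coeff (- p)"
      by blast
    obtain n :: nat where "n \<ge> 1" "real n \<ge> x0"
      by (meson dual_order.trans max.cobounded1 max.cobounded2 of_nat_mono real_arch_simple)
    then show False using assms[of n] x0 pos by fastforce
  qed
  moreover have "p \<noteq> 0" using assms[of 1] by auto
  then have "lead_coeff p \<noteq> 0" by simp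
  ultimately have pos: "lead_coeff p > 0" unfolding degree_minus coeff_minus by linarith
  from poly_pinfty_gt_lc[OF this] obtain x0 where "\<forall>x\<ge>x0. poly p x \<ge> lead_coeff p"
    by blast
  then have "\<forall>\<^sub>F n in sequentially. lead_coeff p \<le> poly p (real n)"
    by (intro eventually_sequentiallyI[of "nat \<lceil>x0\<rceil>"]) (auto simp: nat_le_iff ceiling_le_iff)
  then show ?thesis using pos by blast
qed

text \<open>As exp x \<ge> 1, rounding up at most doubles it, which costs ln 2 in the
  logarithm.\<close>

lemma ln_nat_ceiling_exp:
  fixes x :: real
  assumes "0 \<le> x"
  shows "1 \<le> nat \<lceil>exp x\<rceil>" "real (nat \<lceil>exp x\<rceil>) \<le> 2 * exp x"
    "x \<le> ln (real (nat \<lceil>exp x\<rceil>))" "ln (real (nat \<lceil>exp x\<rceil>)) \<le> x + ln 2"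
proof -
  have 1: "1 \<le> exp x" using assms by simp
  have ge: "exp x \<le> real (nat \<lceil>exp x\<rceil>)" by simp
  have pos: "0 < real (nat \<lceil>exp x\<rceil>)" using 1 ge by linarith
  show "1 \<le> nat \<lceil>exp x\<rceil>" using pos by linarith
  show le: "real (nat \<lceil>exp x\<rceil>) \<le> 2 * exp x" using 1 by linarith
  have "ln (exp x) \<le> ln (real (nat \<lceil>exp x\<rceil>))" by (intro ln_mono ge) auto
  then show "x \<le> ln (real (nat \<lceil>exp x\<rceil>))" by simp
  have "ln (real (nat \<lceil>exp x\<rceil>)) \<le> ln (2 * exp x)" by (intro ln_mono le pos)
  then show "ln (real (nat \<lceil>exp x\<rceil>)) \<le> x + ln 2" by (simp add: ln_mult)
qed

theorem theorem32:
  fixes P :: "('a::finite \<times> 'e::finite) pmf" and p :: "real poly" and R :: real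
  assumes p_pos: "\<And>n::nat. n \<ge> 1 \<Longrightarrow> poly p (real n) > 0"
    and R_ge: "R \<ge> cond_entropy P"
  shows "(\<lambda>n::nat. 1 / real n *
            Delta_I_min (words n) (words n) (nat \<lceil>exp (real n * R)\<rceil>) (poly p (real n)) (iid_pmf n P))
         \<longlonglongrightarrow> R - cond_entropy P"
proof (rule order_tendstoI)
  define H where "H = cond_entropy P"
  define v where "v = measure_pmf.expectation P (\<lambda>x. (cond_info P x - cond_entropy P)\<^sup>2)"
  define M where "M n = nat \<lceil>exp (real n * R)\<rceil>" for n
  define D where "D n = Delta_I_min (words n) (words n) (M n) (poly p (real n)) (iid_pmf n P)" for n
  have R: "0 \<le> H" "H \<le> R" using cond_entropy_nonneg R_ge by (auto simp: H_def)
  have v: "0 \<le> v" unfolding v_def by simp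
  have M: "1 \<le> M n" "real (M n) \<le> 2 * exp (real n * R)"
    "real n * R \<le> ln (real (M n))" "ln (real (M n)) \<le> real n * R + ln 2" for n
    unfolding M_def using R by (intro ln_nat_ceiling_exp; simp)+
  {

    \<comment> \<open>Upper bound on the limit\<close>
    fix x assume x: "R - cond_entropy P < x"
    \<comment> \<open>Half the gap, so that the choice r = n (H - \<delta>) still gives a rate R - H
      + \<delta> below x.\<close>
    define \<delta> where "\<delta> = (x - (R - H)) / 2"
    have \<delta>: "\<delta> > 0" "R - H + \<delta> < x" using x by (auto simp: \<delta>_def H_def field_simps)
    obtain C where C: "C \<ge> 0" "\<And>x. x \<ge> 1 \<Longrightarrow> poly p x \<le> C * x ^ degree p"
      using poly_upper_bound[of p] by blast
    \<comment> \<open>The bound on \<open>D n / n\<close>: smoothing term, constant from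
      \<open>eta_le\<close>, polynomial factor, exponential rate.\<close>
    define U where "U n = v / (n * \<delta>\<^sup>2) * (R + ln 2 / n) + 1 / n + (ln (1 + 2 * C) / n + degree p * (ln n / n))
      + (R - H + \<delta>)" for n :: real
    have "(\<lambda>n. U (real n)) \<longlonglongrightarrow> R - H + \<delta>"
    proof -
      have "(\<lambda>n. v / (real n * \<delta>\<^sup>2)) \<longlonglongrightarrow> 0" "(\<lambda>n. ln 2 / real n) \<longlonglongrightarrow> 0" "(\<lambda>n. 1 / real n) \<longlonglongrightarrow> 0"
        "(\<lambda>n. ln (1 + 2 * C) / real n) \<longlonglongrightarrow> 0" "(\<lambda>n. ln (real n) / real n) \<longlonglongrightarrow> 0"
        using \<delta> by real_asymp+
      then have "(\<lambda>n. U (real n)) \<longlonglongrightarrow> 0 * (R + 0) + 0 + (0 + real (degree p) * 0) + (R - H + \<delta>)"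
        unfolding U_def by (intro tendsto_intros)
      then show ?thesis by simp
    qed
    then have "\<forall>\<^sub>F n in sequentially. U (real n) < x"
      using \<delta>(2) by (rule order_tendstoD)
    moreover have "\<forall>\<^sub>F n in sequentially. 1 / real n * D n \<le> U (real n)"
    proof (rule eventually_sequentiallyI)
      fix n :: nat assume n: "1 \<le> n"
      interpret finite_pair_pmf "words n" "words n" "iid_pmf n P" by (rule iid_finite_pair_pmf)
      define s where "s = v / (real n * \<delta>\<^sup>2)"
      have s: "0 \<le> s" using v by (simp add: s_def)
      have p: "0 < poly p (real n)" using p_pos n by blast
      have "D n \<le> s * ln (real (M n)) + 1 + ln (1 + poly p (real n) * real (M n) * exp (- (real n * (H - \<delta>))))"
        unfolding D_def s_def v_def H_def using \<delta>(1) n p M(1)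
        by (intro Delta_I_min_le prob_iid_above_marginal) auto
      also have "s * ln (real (M n)) \<le> s * (real n * R + ln 2)"
        by (intro mult_left_mono M s)
      also have "ln (1 + poly p (real n) * real (M n) * exp (- (real n * (H - \<delta>))))
          \<le> ln ((1 + 2 * C) * real n ^ degree p * exp (real n * (R - H + \<delta>)))"
      proof (rule ln_mono)
        have "poly p (real n) * real (M n) * exp (- (real n * (H - \<delta>)))
          \<le> (C * real n ^ degree p) * (2 * exp (real n * R)) * exp (- (real n * (H - \<delta>)))"
          using C(2)[of "real n"] C(1) n M(2)[of n] by (intro mult_right_mono mult_mono; simp)
        also have "\<dots> = 2 * C * real n ^ degree p * (exp (real n * R) * exp (- (real n * (H - \<delta>))))"
          by (simp only: mult_ac)
        also have "exp (real n * R) * exp (- (real n * (H - \<delta>))) = exp (real n * (R - H + \<delta>))"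
          unfolding exp_add[symmetric] by (simp add: algebra_simps)
        finally have "poly p (real n) * real (M n) * exp (- (real n * (H - \<delta>)))
          \<le> 2 * C * real n ^ degree p * exp (real n * (R - H + \<delta>))" .
        \<comment> \<open>Both factors are at least 1, so the 1 inside the logarithm is absorbed
          into the coefficient 1 + 2 C.\<close>
        moreover have "1 * 1 \<le> real n ^ degree p * exp (real n * (R - H + \<delta>))"
          using n R \<delta> by (intro mult_mono) auto
        ultimately show "1 + poly p (real n) * real (M n) * exp (- (real n * (H - \<delta>)))
          \<le> (1 + 2 * C) * real n ^ degree p * exp (real n * (R - H + \<delta>))"
          unfolding distrib_right by linarith
        show "0 < 1 + poly p (real n) * real (M n) * exp (- (real n * (H - \<delta>)))"
          using p by (simp add: add_pos_nonneg)
      qed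
      also have "\<dots> = ln (1 + 2 * C) + degree p * ln (real n) + real n * (R - H + \<delta>)"
        using C n by (simp add: ln_mult ln_realpow)
      finally have "D n \<le> s * (real n * R + ln 2) + 1
          + (ln (1 + 2 * C) + degree p * ln (real n) + real n * (R - H + \<delta>))" by simp
      also have "\<dots> = real n * U (real n)"
        using n unfolding U_def s_def[symmetric] by (simp add: distrib_left mult.left_commute)
      finally show "1 / real n * D n \<le> U (real n)" using n by (simp add: field_simps)
    qed
    ultimately show "\<forall>\<^sub>F n in sequentially. 1 / real n * Delta_I_min (words n) (words n)
        (nat \<lceil>exp (real n * R)\<rceil>) (poly p (real n)) (iid_pmf n P) < x"
      unfolding D_def M_def by eventually_elim linarith
  }
  {

    \<comment> \<open>Lower bound on the limit\<close>
    fix x assume x: "x < R - cond_entropy P"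
    \<comment> \<open>A third of the gap: one \<delta> for the typicality threshold t = n (H +
      \<delta>), a second to place the cutoff u = n (H + 2 \<delta>) beyond it, and the third keeps
      the inequality with x strict.\<close>
    define \<delta> where "\<delta> = (R - H - x) / 3"
    have \<delta>: "\<delta> > 0" "x < R - H - 2 * \<delta>" using x by (auto simp: \<delta>_def H_def field_simps)
    obtain c where c: "c > 0" "\<forall>\<^sub>F n in sequentially. c \<le> poly p (real n)"
      using poly_lower_bound[of p] p_pos by blast
    \<comment> \<open>Lower bound on the smoothing distance for r beyond the cutoff; the exponent is
      t - u = - n \<delta>.\<close>
    define q where "q n = 1 - v / (n * \<delta>\<^sup>2) - exp (- (n * \<delta>))" for n :: real
    have q: "(\<lambda>n. q (real n)) \<longlonglongrightarrow> 1" unfolding q_def using \<delta>(1) by real_asymp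
    have "(\<lambda>n. q (real n) * R) \<longlonglongrightarrow> R"
      using tendsto_mult_right[OF q, of R] by simp
    \<comment> \<open>Here x < R - H \<le> R, because H \<ge> 0.\<close>
    then have "\<forall>\<^sub>F n in sequentially. x < q (real n) * R"
      by (rule order_tendstoD) (use R \<delta> in linarith)
    moreover have "(\<lambda>n. ln c / real n + (R - H - 2 * \<delta>)) \<longlonglongrightarrow> R - H - 2 * \<delta>"
      by real_asymp
    then have "\<forall>\<^sub>F n in sequentially. x < ln c / real n + (R - H - 2 * \<delta>)"
      by (rule order_tendstoD) (use \<delta> in linarith)
    \<comment> \<open>The sign of \<open>q\<close> allows n R \<le> ln M to be multiplied by
      it.\<close>
    moreover have "\<forall>\<^sub>F n in sequentially. 0 < q (real n)"
      using q by (rule order_tendstoD) simp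
    ultimately show "\<forall>\<^sub>F n in sequentially. x < 1 / real n * Delta_I_min (words n) (words n)
        (nat \<lceil>exp (real n * R)\<rceil>) (poly p (real n)) (iid_pmf n P)"
      unfolding M_def[symmetric] D_def[symmetric]
      using c(2) eventually_ge_at_top[of 1]
    proof eventually_elim
      case (elim n)
      interpret finite_pair_pmf "words n" "words n" "iid_pmf n P" by (rule iid_finite_pair_pmf)
      have n: "real n > 0" using elim by simp
      have "min ((1 - v / (real n * \<delta>\<^sup>2) - exp (real n * (H + \<delta>) - real n * (H + 2 * \<delta>))) * ln (real (M n)))
          (ln (poly p (real n)) + ln (real (M n)) - real n * (H + 2 * \<delta>)) \<le> D n"
        unfolding D_def v_def H_def using \<delta>(1) n p_pos[of n] M(1)
        by (intro Delta_I_min_ge prob_iid_below_marginal) auto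
      moreover have "1 - v / (real n * \<delta>\<^sup>2) - exp (real n * (H + \<delta>) - real n * (H + 2 * \<delta>)) = q (real n)"
        by (simp add: q_def algebra_simps)
      ultimately have "q (real n) * ln (real (M n)) \<le> D n
          \<or> ln (poly p (real n)) + ln (real (M n)) - real n * (H + 2 * \<delta>) \<le> D n" by auto
      then have "real n * x < D n"
      proof
        assume "q (real n) * ln (real (M n)) \<le> D n"
        moreover have "q (real n) * (real n * R) \<le> q (real n) * ln (real (M n))"
          using elim M(3) by (intro mult_left_mono) auto
        moreover have "real n * x < real n * (q (real n) * R)"
          using elim n by (intro mult_strict_left_mono)
        ultimately show ?thesis by (simp add: mult.left_commute)
      next
        assume "ln (poly p (real n)) + ln (real (M n)) - real n * (H + 2 * \<delta>) \<le> D n"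
        moreover have "ln c \<le> ln (poly p (real n))"
          using elim c(1) by (intro ln_mono) auto
        moreover have "real n * x < real n * (ln c / real n + (R - H - 2 * \<delta>))"
          using elim n by (intro mult_strict_left_mono)
        then have "real n * x < ln c + real n * R - real n * (H + 2 * \<delta>)"
          using n by (simp add: algebra_simps)
        ultimately show ?thesis using M(3)[of n] by linarith
      qed
      then show "x < 1 / real n * D n" using n by (simp add: field_simps)
    qed
  }
qed

end
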